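(* Let $\mathbf n=(n_k)_{k\ge1}$ be a strictly increasing sequence of positive integers and let $\mathcal B=(e_n)$ be a basis of a Banach space $X$. For every $m\in\mathbb N$, $$\max\{g^c_m,\ \omega^{\mathbf n}_m\}\ \le\ \max_{1\le k\le m}\widehat{\mathbf L}^{\mathbf n}_k.$$
   Context: $X$ is a separable infinite-dimensional Banach space over $\mathbb F=\mathbb R$ or $\mathbb C$; $\mathbb N=\{1,2,\dots\}$. A basis of $X$ is a sequence $\mathcal B=(e_n)_{n\ge1}\subset X$ whose linear span is norm-dense and for which there is a sequence $(e_n^* )_{n\ge1}\subset X^*$ with $e_j^*(e_k)=\delta_{j,k}$ and $0<\inf_n\{\|e_n\|,\|e_n^*\|\}\le\sup_n\{\|e_n\|,\|e_n^*\|\}<\infty$ (then $e_n^*(x)\to0$ for every $x$). For a finite set $A\subset\mathbb N$, $P_A(x)=\sum_{n\in A}e_n^*(x)e_n$. For $x\in X$ and an integer $m\ge0$, a greedy set of $x$ of order $m$ is a set $A\subset\mathbb N$ with $|A|=m$ and $\min_{n\in A}|e_n^*(x)|\ge\max_{n\notin A}|e_n^*(x)|$ (the empty set if $m=0$); $G_m(x)$ denotes $P_A(x)$ for such an $A$ (not necessarily unique). The sequence $\mathbf n$ is identified with its set of terms; $P^{\mathbf n}_0(x)=0$, $P^{\mathbf n}_k(x)=\sum_{i=1}^k e_{n_i}^*(x)e_{n_i}$, $\widehat\sigma^{\mathbf n}_m(x)=\min_{0\le k\le m}\|x-P^{\mathbf n}_k(x)\|$. $\gamma_m(x)=\sup_{G_m(x)}\|x-G_m(x)\|$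 (over all choices of $G_m(x)$), and $\widehat{\mathbf L}^{\mathbf n}_m$ is the smallest constant such that $\gamma_m(x)\le\widehat{\mathbf L}^{\mathbf n}_m\,\widehat\sigma^{\mathbf n}_m(x)$ for all $x\in X$. A greedy operator $\mathcal G_m:X\to X$ of order $m$ maps each $x$ to some greedy sum $P_A(x)$, $A$ a greedy set of $x$ of order $m$ (so $\mathcal G_0=0$). For a (possibly nonlinear) map $T:X\to X$, $\|T\|=\sup_{x\ne0}\|T(x)\|/\|x\|$. Define $g^c_m=\sup\{\|I-\mathcal G_k\|:0\le k\le m\}$, the supremum also being over all greedy operators $\mathcal G_k$ of order $k$. A sign is a sequence $\varepsilon=(\varepsilon_n)_n$ of scalars of modulus $1$; $1_{\varepsilon A}=\sum_{n\in A}\varepsilon_ne_n$; $\|x\|_\infty=\max_n|e_n^*(x)|$; $\operatorname{supp}(x)=\{n:e_n^*(x)\ne0\}$. $A<B$ means $a<b$ for all $a\in A,b\in B$ (vacuous if one is empty); $A\le N$ means $a\le N$ for all $a\in A$. Define $$\omega^{\mathbf n}_m=\sup\frac{\|x+1_{\varepsilon A}\|}{\|x+1_{\delta B}\|}$$ over all signs $\varepsilon,\delta$, all $x\in X$ with $\|x\|_\infty\le1$, and all finite sets $A\subset\mathbf n$, $B\subset\mathbb N$ with $|A|\le|B|\le m$, $A\le n_m$, $B\cap\operatorname{supp}(x)=\emptyset$ and $A<(\operatorname{supp}(x)\cup B)\cap\mathbf n$. (Ratios $0/0$ are disregarded.) *)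

theory Defs
  imports "HOL-Analysis.Analysis"
begin

text \<open>
  The scalar field is a type \<open>'f\<close> of class \<open>real_normed_field\<close>. By the Gelfand--Mazur theorem such a
  field is isometrically isomorphic to the real or to the complex numbers, and \<open>real\<close> and \<open>complex\<close>
  are instances, so this covers exactly the two cases of the mathematics. HOL-Analysis provides
  only real scaling on Banach spaces, so the scalar multiplication by \<open>'f\<close> is an explicit parameter
  \<open>smul\<close> which is compatible with the norm and extends the real scaling of the type \<open>'a\<close>.
\<close>

locale sep_inf_banach = vector_space smul
  for smul :: "'f::real_normed_field \<Rightarrow> 'a::banach \<Rightarrow> 'a" +
  assumes norm_scale: "norm (smul c x) = norm c * norm x"
    and scale_of_real: "smul (of_real r) x = r *\<^sub>R x"
    and separable: "\<exists>D::'a set. countable D \<and> closure D = UNIV"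
    and infinite_dimensional: "\<not> (\<exists>S. finite S \<and> span S = UNIV)"

text \<open>
  Sequences are indexed by the positive integers; values at index \<open>0\<close> are never used. The functionals
  \<open>es n\<close> are determined by the basis \<open>e\<close> (density of the span), but are carried along as a
  parameter. The function \<open>onorm\<close> is the dual norm.
\<close>

locale banach_basis = sep_inf_banach smul
  for smul :: "'f::real_normed_field \<Rightarrow> 'a::banach \<Rightarrow> 'a" +
  fixes e :: "nat \<Rightarrow> 'a" and es :: "nat \<Rightarrow> 'a \<Rightarrow> 'f"
  assumes dense_span: "closure (span (e ` {1..})) = UNIV"
    and es_bounded: "n \<ge> 1 \<Longrightarrow> bounded_linear (es n)"
    and es_homogeneous: "n \<ge> 1 \<Longrightarrow> es n (smul c x) = c * es n x"
    and biorthogonal: "j \<ge> 1 \<Longrightarrow> k \<ge> 1 \<Longrightarrow> es j (e k) = (if j = k then 1 else 0)"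
    and norms_bounded_below:
      "0 < Inf ((\<lambda>n. norm (e n)) ` {1..} \<union> (\<lambda>n. onorm (es n)) ` {1..})"
    and norms_bounded_above:
      "bdd_above ((\<lambda>n. norm (e n)) ` {1..} \<union> (\<lambda>n. onorm (es n)) ` {1..})"

definition proj :: "('f::real_normed_field \<Rightarrow> 'a::banach \<Rightarrow> 'a) \<Rightarrow> (nat \<Rightarrow> 'a) \<Rightarrow> (nat \<Rightarrow> 'a \<Rightarrow> 'f)
    \<Rightarrow> nat set \<Rightarrow> 'a \<Rightarrow> 'a" where
  "proj smul e es A x = (\<Sum>n\<in>A. smul (es n x) (e n))"

definition greedy_set :: "(nat \<Rightarrow> 'a::banach \<Rightarrow> 'f::real_normed_field) \<Rightarrow> nat \<Rightarrow> 'a \<Rightarrow> nat set \<Rightarrow> bool"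
  where
  "greedy_set es m x A \<longleftrightarrow> A \<subseteq> {1..} \<and> finite A \<and> card A = m \<and>
     (\<forall>i\<in>A. \<forall>j\<in>{1..} - A. norm (es i x) \<ge> norm (es j x))"

definition gamma :: "('f::real_normed_field \<Rightarrow> 'a::banach \<Rightarrow> 'a) \<Rightarrow> (nat \<Rightarrow> 'a) \<Rightarrow> (nat \<Rightarrow> 'a \<Rightarrow> 'f)
    \<Rightarrow> nat \<Rightarrow> 'a \<Rightarrow> ennreal" where
  "gamma smul e es m x = (SUP A\<in>{A. greedy_set es m x A}. ennreal (norm (x - proj smul e es A x)))"

definition seq_proj :: "('f::real_normed_field \<Rightarrow> 'a::banach \<Rightarrow> 'a) \<Rightarrow> (nat \<Rightarrow> 'a)
    \<Rightarrow> (nat \<Rightarrow> 'a \<Rightarrow> 'f) \<Rightarrow> (nat \<Rightarrow> nat) \<Rightarrow> nat \<Rightarrow> 'a \<Rightarrow> 'a" where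
  "seq_proj smul e es nn k x = (\<Sum>i=1..k. smul (es (nn i) x) (e (nn i)))"

definition sigma_hat :: "('f::real_normed_field \<Rightarrow> 'a::banach \<Rightarrow> 'a) \<Rightarrow> (nat \<Rightarrow> 'a)
    \<Rightarrow> (nat \<Rightarrow> 'a \<Rightarrow> 'f) \<Rightarrow> (nat \<Rightarrow> nat) \<Rightarrow> nat \<Rightarrow> 'a \<Rightarrow> real" where
  "sigma_hat smul e es nn m x = Min ((\<lambda>k. norm (x - seq_proj smul e es nn k x)) ` {0..m})"

text \<open>
  The constants below take values in \<open>ennreal\<close>, as they may be infinite. The infimum in the next
  definition is over a set closed under limits, hence it is the smallest constant (\<open>\<infinity>\<close> if no finite
  constant works).
\<close>

definition L_hat :: "('f::real_normed_field \<Rightarrow> 'a::banach \<Rightarrow> 'a) \<Rightarrow> (nat \<Rightarrow> 'a) \<Rightarrow> (nat \<Rightarrow> 'a \<Rightarrow> 'f)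
    \<Rightarrow> (nat \<Rightarrow> nat) \<Rightarrow> nat \<Rightarrow> ennreal" where
  "L_hat smul e es nn m =
     Inf {C. \<forall>x. gamma smul e es m x \<le> C * ennreal (sigma_hat smul e es nn m x)}"

definition greedy_operator :: "('f::real_normed_field \<Rightarrow> 'a::banach \<Rightarrow> 'a) \<Rightarrow> (nat \<Rightarrow> 'a)
    \<Rightarrow> (nat \<Rightarrow> 'a \<Rightarrow> 'f) \<Rightarrow> nat \<Rightarrow> ('a \<Rightarrow> 'a) \<Rightarrow> bool" where
  "greedy_operator smul e es m G \<longleftrightarrow>
     (\<forall>x. \<exists>A. greedy_set es m x A \<and> G x = proj smul e es A x)"

text \<open>The operator norm of a possibly nonlinear map (\<open>onorm\<close> takes values in \<open>real\<close>).\<close>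

definition map_norm :: "('a::real_normed_vector \<Rightarrow> 'a) \<Rightarrow> ennreal" where
  "map_norm T = (SUP x\<in>UNIV - {0}. ennreal (norm (T x) / norm x))"

definition gc :: "('f::real_normed_field \<Rightarrow> 'a::banach \<Rightarrow> 'a) \<Rightarrow> (nat \<Rightarrow> 'a) \<Rightarrow> (nat \<Rightarrow> 'a \<Rightarrow> 'f)
    \<Rightarrow> nat \<Rightarrow> ennreal" where
  "gc smul e es m =
     Sup {map_norm (\<lambda>x. x - G x) | G k. k \<le> m \<and> greedy_operator smul e es k G}"

definition is_sign :: "(nat \<Rightarrow> 'f::real_normed_field) \<Rightarrow> bool" where
  "is_sign \<epsilon> \<longleftrightarrow> (\<forall>n\<ge>1. norm (\<epsilon> n) = 1)"

definition signed_sum :: "('f::real_normed_field \<Rightarrow> 'a::banach \<Rightarrow> 'a) \<Rightarrow> (nat \<Rightarrow> 'a)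
    \<Rightarrow> (nat \<Rightarrow> 'f) \<Rightarrow> nat set \<Rightarrow> 'a" where
  "signed_sum smul e \<epsilon> A = (\<Sum>n\<in>A. smul (\<epsilon> n) (e n))"

text \<open>The supremum is a maximum, since the coefficients of a vector tend to zero.\<close>

definition coeff_sup_norm :: "(nat \<Rightarrow> 'a::banach \<Rightarrow> 'f::real_normed_field) \<Rightarrow> 'a \<Rightarrow> real" where
  "coeff_sup_norm es x = (SUP n\<in>{1..}. norm (es n x))"

definition supp :: "(nat \<Rightarrow> 'a::banach \<Rightarrow> 'f::real_normed_field) \<Rightarrow> 'a \<Rightarrow> nat set" where
  "supp es x = {n \<in> {1..}. es n x \<noteq> 0}"

definition set_less :: "nat set \<Rightarrow> nat set \<Rightarrow> bool" where
  "set_less A B \<longleftrightarrow> (\<forall>a\<in>A. \<forall>b\<in>B. a < b)"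

text \<open>
  The set of terms of the sequence \<open>nn\<close> is \<open>nn ` {1..}\<close>. The last condition discards the ratios
  \<open>0/0\<close>; a positive number divided by \<open>0\<close> is \<open>\<infinity>\<close> in \<open>ennreal\<close>.
\<close>

definition omega :: "('f::real_normed_field \<Rightarrow> 'a::banach \<Rightarrow> 'a) \<Rightarrow> (nat \<Rightarrow> 'a) \<Rightarrow> (nat \<Rightarrow> 'a \<Rightarrow> 'f)
    \<Rightarrow> (nat \<Rightarrow> nat) \<Rightarrow> nat \<Rightarrow> ennreal" where
  "omega smul e es nn m = Sup
     {ennreal (norm (x + signed_sum smul e \<epsilon> A)) / ennreal (norm (x + signed_sum smul e \<delta> B))
      | x A B \<epsilon> \<delta>.
        is_sign \<epsilon> \<and> is_sign \<delta> \<and> coeff_sup_norm es x \<le> 1 \<and>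
        finite A \<and> finite B \<and> A \<subseteq> nn ` {1..} \<and> B \<subseteq> {1..} \<and>
        card A \<le> card B \<and> card B \<le> m \<and> (\<forall>a\<in>A. a \<le> nn m) \<and>
        B \<inter> supp es x = {} \<and> set_less A ((supp es x \<union> B) \<inter> nn ` {1..}) \<and>
        \<not> (x + signed_sum smul e \<epsilon> A = 0 \<and> x + signed_sum smul e \<delta> B = 0)}"

end

theory Submission
  imports Defs
begin

text \<open>
  Every lower bound for the constant \<open>L_hat\<close> of order \<open>k\<close> comes from one vector \<open>y\<close>, one greedy set
  \<open>G\<close> of \<open>y\<close> of order \<open>k\<close> and one \<open>j \<le> k\<close>, through the quotient of the residuals
  \<open>\<parallel>y - P\<^sub>G y\<parallel>\<close> and \<open>\<parallel>y - P\<^sub>j y\<parallel>\<close> (lemma \<open>residual_quotient_le_L_hat\<close>).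

  For the greedy operators of order \<open>k \<ge> 1\<close> the choice \<open>j = 0\<close> is enough, because \<open>P\<^sub>0 = 0\<close>.
  For order \<open>0\<close>, where the residual operator is the identity, one has to see that
  \<open>1 \<le> L_hat\<close> at order \<open>1\<close>.

  For \<open>omega\<close>, let \<open>x, A, B\<close> be admissible. The vector \<open>y = x + 1\<^sub>A + 1\<^sub>B\<close> (with signs) has \<open>B\<close>
  as a greedy set, and deleting \<open>B\<close> from it leaves the numerator. Let \<open>n\<^sub>j\<close> be the last
  element of \<open>A\<close>; since \<open>A\<close> precedes all other terms of the sequence at which \<open>y\<close> is nonzero,
  \<open>P\<^sub>j\<close> deletes exactly \<open>A\<close> and leaves the denominator. The difficulty is that \<open>j\<close> may exceed
  \<open>card B\<close>, so that \<open>P\<^sub>j\<close> does not compete with greedy sums of order \<open>card B\<close>. This is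
  repaired by padding: among the \<open>j - card A \<ge> j - card B\<close> gaps \<open>{n\<^sub>1, \<dots>, n\<^sub>j} - A\<close>, where \<open>y\<close> vanishes, a set \<open>D\<close> of
  \<open>j - card B\<close> positions (none if \<open>j \<le> card B\<close>) receives the coefficient \<open>1\<close>. Both the greedy sum over \<open>B \<union> D\<close> and \<open>P\<^sub>j\<close>
  delete the padding, so neither residual changes, while the order of the greedy sum rises to
  \<open>max j (card B) \<le> m\<close>. The same comparison of residuals (lemma \<open>padded_quotient_le_L_hat\<close>) also
  gives \<open>1 \<le> L_hat\<close> at order \<open>1\<close>.
\<close>

lemma seq_proj_eq_proj_image:
  assumes "inj_on nn {1..}"
  shows "seq_proj smul e es nn j y = proj smul e es (nn ` {1..j}) y"
proof -
  have "inj_on nn {1..j}" using assms by (rule inj_on_subset) auto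
  then show ?thesis by (simp add: seq_proj_def proj_def sum.reindex)
qed

text \<open>
  The quotient is bounded by each constant in the set defining \<open>L_hat\<close>, so it is not necessary to
  know that the infimum belongs to that set. A vanishing denominator does no harm: the
  numerator then vanishes as well, and \<open>0 / 0 = 0\<close> in \<open>ennreal\<close>.
\<close>

lemma residual_quotient_le_L_hat:
  assumes G: "greedy_set es k y G" and "j \<le> k"
  shows "ennreal (norm (y - proj smul e es G y)) / ennreal (norm (y - seq_proj smul e es nn j y))
    \<le> L_hat smul e es nn k"
  unfolding L_hat_def
proof (rule Inf_greatest, clarify)
  fix C
  assume C: "\<forall>x. gamma smul e es k x \<le> C * ennreal (sigma_hat smul e es nn k x)"
  let ?b = "norm (y - seq_proj smul e es nn j y)"
  have "ennreal (norm (y - proj smul e es G y)) \<le> gamma smul e es k y"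
    unfolding gamma_def using G by (auto intro: SUP_upper)
  also have "\<dots> \<le> C * ennreal (sigma_hat smul e es nn k y)" using C by blast
  also have "\<dots> \<le> C * ennreal ?b"
    unfolding sigma_hat_def using \<open>j \<le> k\<close> by (intro mult_left_mono ennreal_leI Min_le) auto
  finally have le: "ennreal (norm (y - proj smul e es G y)) \<le> ennreal ?b * C"
    by (simp add: mult.commute)
  show "ennreal (norm (y - proj smul e es G y)) / ennreal ?b \<le> C"
  proof (cases "?b = 0")
    case True
    then show ?thesis using le by simp
  next
    case False
    then show ?thesis using le by (intro divide_le_posI_ennreal) auto
  qed
qed

context banach_basis
begin

lemma coeff_add:
  assumes "n \<ge> 1"
  shows "es n (x + y) = es n x + es n y"
  using es_bounded[OF assms] by (simp add: bounded_linear.linear linear_add)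

lemma coeff_signed_sum:
  assumes "n \<ge> 1" "B \<subseteq> {1..}" "finite B"
  shows "es n (signed_sum smul e \<epsilon> B) = (if n \<in> B then \<epsilon> n else 0)"
proof -
  have "es n (signed_sum smul e \<epsilon> B) = (\<Sum>i\<in>B. es n (smul (\<epsilon> i) (e i)))"
    unfolding signed_sum_def
    using es_bounded[OF assms(1)] by (simp add: bounded_linear.linear linear_sum)
  also have "\<dots> = (\<Sum>i\<in>B. if n = i then \<epsilon> i else 0)"
    using assms by (intro sum.cong) (auto simp: es_homogeneous biorthogonal)
  also have "\<dots> = (if n \<in> B then \<epsilon> n else 0)" using assms(3) by simp
  finally show ?thesis .
qed

text \<open>
  The supremum in \<open>coeff_sup_norm\<close> is a genuine upper bound because the dual norms of the
  coordinate functionals are uniformly bounded.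
\<close>

lemma norm_coeff_le_coeff_sup_norm:
  assumes "n \<ge> 1"
  shows "norm (es n x) \<le> coeff_sup_norm es x"
proof -
  obtain M where M: "\<And>k. k \<ge> 1 \<Longrightarrow> onorm (es k) \<le> M"
    using norms_bounded_above unfolding bdd_above_def by auto
  have "norm (es k x) \<le> M * norm x" if "k \<ge> 1" for k
    using onorm[OF es_bounded[OF that], of x] M[OF that]
    by (meson mult_right_mono norm_ge_zero order_trans)
  then have "bdd_above ((\<lambda>k. norm (es k x)) ` {1..})" by (intro bdd_aboveI2) auto
  then show ?thesis unfolding coeff_sup_norm_def using assms by (intro cSUP_upper) auto
qed

text \<open>
  The padded comparison: all coefficients of \<open>x + 1\<^sub>A + 1\<^sub>B + 1\<^sub>D\<close> have modulus at most \<open>1\<close>, with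
  equality on \<open>B \<union> D\<close>, which is therefore a greedy set. The padding \<open>D\<close> enters through the
  cardinality only, as it is deleted on both sides.
\<close>

lemma padded_quotient_le_L_hat:
  assumes nn: "inj_on nn {1..}"
    and signs: "is_sign \<epsilon>" "is_sign \<delta>"
    and x: "\<And>n. n \<ge> 1 \<Longrightarrow> norm (es n x) \<le> 1"
    and fin: "finite B"
    and pos: "nn ` {1..j} \<subseteq> {1..}" "B \<subseteq> {1..}"
    and init: "A \<subseteq> nn ` {1..j}" "D \<subseteq> nn ` {1..j}"
    and disj: "A \<inter> D = {}" "B \<inter> supp es x = {}" "nn ` {1..j} \<inter> (supp es x \<union> B) = {}"
    and card: "j \<le> card (B \<union> D)"
  shows "ennreal (norm (x + signed_sum smul e \<epsilon> A)) / ennreal (norm (x + signed_sum smul e \<delta> B))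
    \<le> L_hat smul e es nn (card (B \<union> D))"
proof -
  define y where "y = x + signed_sum smul e \<epsilon> A + signed_sum smul e \<delta> B
    + signed_sum smul e (\<lambda>_. 1) D"
  have finAD: "finite A" "finite D" using init by (auto intro: finite_subset)
  have posAD: "A \<subseteq> {1..}" "D \<subseteq> {1..}" using init pos by auto
  have BD: "A \<inter> B = {}" "B \<inter> D = {}" using init disj by auto
  have coeff: "es n y = es n x + (if n \<in> A then \<epsilon> n else 0) + (if n \<in> B then \<delta> n else 0)
      + (if n \<in> D then 1 else 0)" if "n \<ge> 1" for n
    using that fin finAD pos posAD by (simp add: y_def coeff_add coeff_signed_sum)
  have x0: "es n x = 0" if "n \<ge> 1" "n \<in> B \<union> nn ` {1..j}" for n
    using disj that by (auto simp: supp_def)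
  have y_A: "es n y = \<epsilon> n" if "n \<in> A" for n
  proof -
    have "n \<ge> 1" "n \<in> nn ` {1..j}" "n \<notin> B" "n \<notin> D" using that posAD init disj(1) BD by auto
    then show ?thesis using that coeff[of n] x0[of n] by simp
  qed
  have y_B: "es n y = \<delta> n" if "n \<in> B" for n
  proof -
    have "n \<ge> 1" "n \<notin> A" "n \<notin> D" using that pos BD by auto
    then show ?thesis using that coeff[of n] x0[of n] by simp
  qed
  have y_D: "es n y = 1" if "n \<in> D" for n
  proof -
    have "n \<ge> 1" "n \<in> nn ` {1..j}" "n \<notin> A" "n \<notin> B" using that posAD init disj(1) BD by auto
    then show ?thesis using that coeff[of n] x0[of n] by simp
  qed
  have y_gap: "es n y = 0" if "n \<in> nn ` {1..j} - (A \<union> D)" for n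
  proof -
    have "n \<ge> 1" "n \<notin> B" using that pos disj by auto
    then show ?thesis using that coeff[of n] x0[of n] by auto
  qed
  have proj_A: "proj smul e es A y = signed_sum smul e \<epsilon> A"
    and proj_B: "proj smul e es B y = signed_sum smul e \<delta> B"
    and proj_D: "proj smul e es D y = signed_sum smul e (\<lambda>_. 1) D"
    by (simp_all add: proj_def signed_sum_def y_A y_B y_D)
  have proj_un: "proj smul e es (S \<union> D) y = proj smul e es S y + proj smul e es D y"
    if "finite S" "S \<inter> D = {}" for S
    unfolding proj_def using that finAD by (intro sum.union_disjoint) auto
  have proj_init: "proj smul e es (nn ` {1..j}) y = proj smul e es (A \<union> D) y"
    unfolding proj_def using init y_gap by (intro sum.mono_neutral_right) auto
  have one: "norm (es n y) = 1" if "n \<in> B \<union> D" for n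
    using that pos signs y_B y_D by (auto simp: is_sign_def)
  have le_one: "norm (es n y) \<le> 1" if "n \<ge> 1" "n \<notin> B \<union> D" for n
  proof (cases "n \<in> A")
    case True
    then show ?thesis using that signs y_A by (simp add: is_sign_def)
  next
    case False
    then show ?thesis using that coeff[of n] x[of n] by simp
  qed
  have "greedy_set es (card (B \<union> D)) y (B \<union> D)"
    unfolding greedy_set_def using fin finAD pos posAD one le_one by auto
  note quotient = residual_quotient_le_L_hat[OF this card, of smul e nn]
  have "y - proj smul e es (B \<union> D) y = x + signed_sum smul e \<epsilon> A"
    using proj_un[OF fin BD(2)] by (simp add: proj_B proj_D) (simp add: y_def)
  moreover have "y - seq_proj smul e es nn j y = x + signed_sum smul e \<delta> B"
    using proj_un[OF finAD(1) disj(1)]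
    by (simp add: seq_proj_eq_proj_image[OF nn] proj_init proj_A proj_D del: One_nat_def)
       (simp add: y_def)
  ultimately show ?thesis using quotient by simp
qed

text \<open>
  With \<open>A = B = {}\<close> and padding at the first term of the sequence, both residuals of
  \<open>e p + e (nn 1)\<close> are \<open>e p\<close>.
\<close>

lemma one_le_L_hat_one:
  assumes nn: "inj_on nn {1..}" and "nn 1 \<ge> 1"
  shows "1 \<le> L_hat smul e es nn 1"
proof -
  define p where "p = Suc (nn 1)"
  have coeff: "es n (e p) = (if n = p then 1 else 0)" if "n \<ge> 1" for n
    using that by (simp add: biorthogonal p_def)
  have "e p \<noteq> 0"
  proof
    assume "e p = 0"
    then have "es p (e p) = 0"
      using es_bounded[of p] by (simp add: p_def bounded_linear.linear linear_0)
    then show False using coeff[of p] by (simp add: p_def)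
  qed
  then have "1 = ennreal (norm (e p)) / ennreal (norm (e p))"
    by (simp add: divide_ennreal)
  also have "\<dots> \<le> L_hat smul e es nn 1"
    using padded_quotient_le_L_hat[OF nn, where \<epsilon> = "\<lambda>_. 1" and \<delta> = "\<lambda>_. 1"
        and x = "e p" and A = "{}" and B = "{}" and D = "{nn 1}" and j = 1]
      coeff assms(2)
    by (auto simp: is_sign_def signed_sum_def supp_def p_def)
  finally show ?thesis .
qed

lemma gc_le_Max_L_hat:
  assumes nn: "inj_on nn {1..}" and "nn 1 \<ge> 1" and "m \<ge> 1"
  shows "gc smul e es m \<le> Max ((\<lambda>k. L_hat smul e es nn k) ` {1..m})"
  unfolding gc_def
proof (rule Sup_least, clarify)
  fix G k
  assume "k \<le> m" and G: "greedy_operator smul e es k G"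
  let ?M = "Max ((\<lambda>k. L_hat smul e es nn k) ` {1..m})"
  have Max_ge_L: "L_hat smul e es nn i \<le> ?M" if "1 \<le> i" "i \<le> m" for i
    using that by (intro Max_ge) auto
  show "map_norm (\<lambda>x. x - G x) \<le> ?M"
    unfolding map_norm_def
  proof (rule SUP_least)
    fix x :: 'a
    assume "x \<in> UNIV - {0}"
    then have x: "norm x > 0" by simp
    obtain S where S: "greedy_set es k x S" "G x = proj smul e es S x"
      using G unfolding greedy_operator_def by blast
    show "ennreal (norm (x - G x) / norm x) \<le> ?M"
    proof (cases "k = 0")
      case True
      then have "S = {}" using S(1) by (auto simp: greedy_set_def)
      then have "ennreal (norm (x - G x) / norm x) = 1" using S(2) x by (simp add: proj_def)
      also have "\<dots> \<le> L_hat smul e es nn 1" by (rule one_le_L_hat_one) fact+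
      also have "\<dots> \<le> ?M" using \<open>m \<ge> 1\<close> by (intro Max_ge_L) auto
      finally show ?thesis .
    next
      case False
      have "ennreal (norm (x - G x) / norm x) \<le> L_hat smul e es nn k"
        using residual_quotient_le_L_hat[OF S(1), of 0 smul e nn] S(2) x
        by (simp add: seq_proj_def divide_ennreal)
      also have "\<dots> \<le> ?M" using False \<open>k \<le> m\<close> by (intro Max_ge_L) auto
      finally show ?thesis .
    qed
  qed
qed

text \<open>
  The segment \<open>{n\<^sub>1, \<dots>, n\<^sub>j}\<close> ending at the last element of \<open>A\<close> (empty for \<open>A = {}\<close>) is where
  the padding set is chosen. The bound \<open>n\<^sub>m\<close> on \<open>A\<close> gives \<open>j \<le> m\<close>, so the padded order is at most
  \<open>m\<close>, and the order condition on \<open>A\<close> keeps the segment away from \<open>B\<close> and the support of \<open>x\<close>.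
\<close>

lemma omega_le_Max_L_hat:
  assumes mono: "strict_mono_on {1..} nn" and pos: "\<forall>k\<ge>1. nn k \<ge> 1" and "m \<ge> 1"
  shows "omega smul e es nn m \<le> Max ((\<lambda>k. L_hat smul e es nn k) ` {1..m})"
  unfolding omega_def
proof (rule Sup_least, clarify)
  fix x A B and \<epsilon> \<delta> :: "nat \<Rightarrow> 'f"
  assume signs: "is_sign \<epsilon>" "is_sign \<delta>" and x: "coeff_sup_norm es x \<le> 1"
    and fin: "finite A" "finite B" and A: "A \<subseteq> nn ` {1..}" and B: "B \<subseteq> {1..}"
    and card: "card A \<le> card B" "card B \<le> m" and A_le: "\<forall>a\<in>A. a \<le> nn m"
    and B_supp: "B \<inter> supp es x = {}"
    and less: "set_less A ((supp es x \<union> B) \<inter> nn ` {1..})"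
  let ?M = "Max ((\<lambda>k. L_hat smul e es nn k) ` {1..m})"
  let ?Q = "ennreal (norm (x + signed_sum smul e \<epsilon> A)) / ennreal (norm (x + signed_sum smul e \<delta> B))"
  have Max_ge_L: "L_hat smul e es nn i \<le> ?M" if "1 \<le> i" "i \<le> m" for i
    using that by (intro Max_ge) auto
  have inj: "inj_on nn {1..}" using mono by (rule strict_mono_on_imp_inj_on)
  have le_iff: "nn i \<le> nn k \<longleftrightarrow> i \<le> k" if "i \<ge> 1" "k \<ge> 1" for i k
    using strict_mono_on_less_eq[OF mono] that by auto
  obtain j where j: "j \<le> m" "A \<subseteq> nn ` {1..j}" "nn ` {1..j} \<inter> (supp es x \<union> B) = {}"
  proof (cases "A = {}")
    case True
    then show ?thesis using that[of 0] by simp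
  next
    case False
    then have Max_A: "Max A \<in> A" using fin by simp
    then obtain j where j: "j \<ge> 1" "Max A = nn j" using A by auto
    show ?thesis
    proof (rule that)
      show "j \<le> m" using A_le Max_A j \<open>m \<ge> 1\<close> le_iff by metis
      show "A \<subseteq> nn ` {1..j}"
      proof
        fix a
        assume a: "a \<in> A"
        then obtain i where i: "i \<ge> 1" "a = nn i" using A by auto
        moreover have "a \<le> nn j" using a fin(1) j(2) by (metis Max_ge)
        ultimately show "a \<in> nn ` {1..j}" using le_iff j(1) by auto
      qed
      show "nn ` {1..j} \<inter> (supp es x \<union> B) = {}"
      proof (rule ccontr)
        assume "\<not> ?thesis"
        then obtain i where i: "i \<in> {1..j}" "nn i \<in> supp es x \<union> B" by blast
        then have "nn j < nn i" using less Max_A j(2) unfolding set_less_def by force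
        then show False using le_iff[of i j] i(1) by simp
      qed
    qed
  qed
  have card_init: "card (nn ` {1..j}) = j"
    using inj_on_subset[OF inj, of "{1..j}"] by (simp add: card_image)
  show "?Q \<le> ?M"
  proof (cases "B = {}")
    case True
    \<comment> \<open>Here the greedy set would have order \<open>0\<close>; the quotient is trivial instead.\<close>
    then have "A = {}" using card fin by simp
    then have "?Q \<le> 1" using True by (cases "x = 0") (auto simp: signed_sum_def divide_ennreal)
    also have "\<dots> \<le> L_hat smul e es nn 1" using inj pos by (intro one_le_L_hat_one) auto
    also have "\<dots> \<le> ?M" using \<open>m \<ge> 1\<close> by (intro Max_ge_L) auto
    finally show ?thesis .
  next
    case False
    have "card (nn ` {1..j} - A) = j - card A"
      using card_init j(2) fin by (simp add: card_Diff_subset)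
    then have "j - card B \<le> card (nn ` {1..j} - A)" using card by simp
    then obtain D where D: "D \<subseteq> nn ` {1..j} - A" "card D = j - card B" "finite D"
      by (rule obtain_subset_with_card_n)
    have "B \<inter> D = {}" using D(1) j(3) by auto
    then have card_BD: "card (B \<union> D) = max j (card B)"
      using fin D by (simp add: card_Un_disjoint)
    have "card B \<ge> 1" using False fin by (simp add: Suc_le_eq card_gt_0_iff)
    have "norm (es n x) \<le> 1" if "n \<ge> 1" for n
      using norm_coeff_le_coeff_sup_norm[OF that, of x] x by simp
    moreover have "nn ` {1..j} \<subseteq> {1..}" using pos by auto
    moreover have "A \<inter> D = {}" "D \<subseteq> nn ` {1..j}" using D(1) by auto
    moreover have "j \<le> card (B \<union> D)" using card_BD by simp
    ultimately have "?Q \<le> L_hat smul e es nn (card (B \<union> D))"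
      using inj signs fin B B_supp j by (intro padded_quotient_le_L_hat) auto
    also have "\<dots> \<le> ?M"
      unfolding card_BD using \<open>card B \<ge> 1\<close> card j(1) by (intro Max_ge_L) auto
    finally show ?thesis .
  qed
qed

end

theorem theorem4p3:
  fixes smul :: "'f::real_normed_field \<Rightarrow> 'a::banach \<Rightarrow> 'a"
    and e :: "nat \<Rightarrow> 'a" and es :: "nat \<Rightarrow> 'a \<Rightarrow> 'f"
    and nn :: "nat \<Rightarrow> nat" and m :: nat
  assumes "banach_basis smul e es"
    and "strict_mono_on {1..} nn" and "\<forall>k\<ge>1. nn k \<ge> 1"
    and "m \<ge> 1"
  shows "max (gc smul e es m) (omega smul e es nn m)
    \<le> Max ((\<lambda>k. L_hat smul e es nn k) ` {1..m})"
proof -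
  interpret banach_basis smul e es by fact
  have "inj_on nn {1..}" using assms(2) by (rule strict_mono_on_imp_inj_on)
  then show ?thesis
    using gc_le_Max_L_hat omega_le_Max_L_hat assms by (intro max.boundedI) auto
qed

end
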